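(* Let $F$ be a field, let $n\ge 1$, and let $F[X_1,\dots,X_n]$ be the polynomial algebra in $n$ commuting variables over $F$. For $q\in F[X_1,\dots,X_n]$, let $m_q$ be the linear endomorphism "multiplication by $q$" of $F[X_1,\dots,X_n]$. Let $\alpha,\beta_1,\dots,\beta_n,\gamma_1,\dots,\gamma_n\in F$, where $\alpha\neq 0$. Then: (1) $F[X_1,\dots,X_n]$ is a faithful $\mathfrak{h}(n)$-module via $$z\mapsto \alpha\cdot I,\quad x_i\mapsto \beta_i\cdot I+\alpha\cdot\partial/\partial X_i,\quad y_i\mapsto \gamma_i\cdot I+m_{X_i}\qquad(1\le i\le n).$$ (2) The $\mathfrak{h}(n)$-module $F[X_1,\dots,X_n]$ of (1) is irreducible if and only if $F$ has characteristic $0$. (3) Suppose $F$ has prime characteristic $p$. Then the ideal $(X_1^p,\dots,X_n^p)$ is an $\mathfrak{h}(n)$-invariant subspace of $F[X_1,\dots,X_n]$ and $$V_{\alpha,\beta_1,\dots,\beta_n,\gamma_1,\dots,\gamma_n}=F[X_1,\dots,X_n]/(X_1^p,\dots,X_n^p)$$ is a faithful irreducible $\mathfrak{h}(n)$-module of dimension $p^n$. Moreover, for $\alpha',\beta'_1,\dots,\beta'_n,\gamma'_1,\dots,\gamma'_n\in F$ with $\alpha'\ne 0$, the module $V_{\alpha,\beta_1,\dots,\beta_n,\gamma_1,\dots,\gamma_n}$ is isomorphic to $V_{\alpha',\beta'_1,\dots,\beta'_n,\gamma'_1,\dots,\gamma'_n}$ if and only if $\alpha=\alpha'$ and $\beta_i=\beta'_i$,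 $\gamma_i=\gamma'_i$ for all $1\leq i\leq n$. Furthermore, $V_{\alpha,\beta_1,\dots,\beta_n,\gamma_1,\dots,\gamma_n}$ is equivalent to $V_{1,0,\dots,0}$ (the module with $\alpha=1$ and all $\beta_i=\gamma_i=0$).
   Context: For $n\ge 1$, the Heisenberg algebra $\mathfrak{h}(n)=\mathfrak{h}(n,F)$ is the Lie algebra over $F$ with basis $x_1,\dots,x_n,y_1,\dots,y_n,z$ and brackets $[x_i,y_i]=z$ for $1\le i\le n$, all other brackets between basis elements (apart from $[y_i,x_i]=-z$) being zero. Two representations $R$ and $T$ of a Lie algebra $\mathfrak{g}$ are called equivalent if there is an automorphism $\Omega\in\mathrm{Aut}(\mathfrak{g})$ such that $T$ is similar to (i.e. isomorphic as a representation to) $R\circ\Omega$. The module $F[X_1,\dots,X_n]$ is infinite dimensional. *)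

theory Defs
  imports "HOL-Library.Poly_Mapping" "HOL-Library.Cardinality" "HOL-Computational_Algebra.Computational_Algebra"
begin

section \<open>Lie algebras and their modules\<close>

locale lie_algebra = vector_space scale
  for scale :: "'a::field \<Rightarrow> 'g::ab_group_add \<Rightarrow> 'g" +
  fixes bracket :: "'g \<Rightarrow> 'g \<Rightarrow> 'g"
  assumes linear_bracket_left: "Vector_Spaces.linear scale scale (\<lambda>u. bracket u v)"
    and linear_bracket_right: "Vector_Spaces.linear scale scale (bracket u)"
    and bracket_self: "bracket u u = 0"
    and jacobi: "bracket u (bracket v w) + bracket v (bracket w u) + bracket w (bracket u v) = 0"

locale lie_module = lie_algebra scale bracket + V: vector_space scaleV
  for scale :: "'a::field \<Rightarrow> 'g::ab_group_add \<Rightarrow> 'g"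
    and bracket :: "'g \<Rightarrow> 'g \<Rightarrow> 'g"
    and scaleV :: "'a \<Rightarrow> 'v::ab_group_add \<Rightarrow> 'v" +
  fixes act :: "'g \<Rightarrow> 'v \<Rightarrow> 'v"
  assumes linear_act_left: "Vector_Spaces.linear scale scaleV (\<lambda>u. act u v)"
    and linear_act_right: "Vector_Spaces.linear scaleV scaleV (act u)"
    and act_bracket: "act (bracket u w) v = act u (act w v) - act w (act u v)"

definition faithful_act :: "('g \<Rightarrow> 'v \<Rightarrow> 'v) \<Rightarrow> bool" where
  "faithful_act act \<longleftrightarrow> inj act"

definition invariant_subspace ::
  "('a::field \<Rightarrow> 'v::ab_group_add \<Rightarrow> 'v) \<Rightarrow> ('g \<Rightarrow> 'v \<Rightarrow> 'v) \<Rightarrow> 'v set \<Rightarrow> bool" where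
  "invariant_subspace scaleV act W \<longleftrightarrow>
     module.subspace scaleV W \<and> (\<forall>u. \<forall>w\<in>W. act u w \<in> W)"

definition irreducible_act ::
  "('a::field \<Rightarrow> 'v::ab_group_add \<Rightarrow> 'v) \<Rightarrow> ('g \<Rightarrow> 'v \<Rightarrow> 'v) \<Rightarrow> bool" where
  "irreducible_act scaleV act \<longleftrightarrow>
     (UNIV :: 'v set) \<noteq> {0} \<and>
     (\<forall>W. invariant_subspace scaleV act W \<longrightarrow> W = {0} \<or> W = UNIV)"

definition isomorphic_act ::
  "('a::field \<Rightarrow> 'v::ab_group_add \<Rightarrow> 'v) \<Rightarrow> ('g \<Rightarrow> 'v \<Rightarrow> 'v) \<Rightarrow>
   ('a \<Rightarrow> 'w::ab_group_add \<Rightarrow> 'w) \<Rightarrow> ('g \<Rightarrow> 'w \<Rightarrow> 'w) \<Rightarrow> bool" where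
  "isomorphic_act scaleV actV scaleW actW \<longleftrightarrow>
     (\<exists>\<phi>. Vector_Spaces.linear scaleV scaleW \<phi> \<and> bij \<phi> \<and>
          (\<forall>u v. \<phi> (actV u v) = actW u (\<phi> v)))"

definition lie_automorphism ::
  "('a::field \<Rightarrow> 'g::ab_group_add \<Rightarrow> 'g) \<Rightarrow> ('g \<Rightarrow> 'g \<Rightarrow> 'g) \<Rightarrow> ('g \<Rightarrow> 'g) \<Rightarrow> bool" where
  "lie_automorphism scale bracket \<Omega> \<longleftrightarrow>
     Vector_Spaces.linear scale scale \<Omega> \<and> bij \<Omega> \<and>
     (\<forall>u v. \<Omega> (bracket u v) = bracket (\<Omega> u) (\<Omega> v))"

definition equivalent_act ::
  "('a::field \<Rightarrow> 'g::ab_group_add \<Rightarrow> 'g) \<Rightarrow> ('g \<Rightarrow> 'g \<Rightarrow> 'g) \<Rightarrow>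
   ('a \<Rightarrow> 'v::ab_group_add \<Rightarrow> 'v) \<Rightarrow> ('g \<Rightarrow> 'v \<Rightarrow> 'v) \<Rightarrow>
   ('a \<Rightarrow> 'w::ab_group_add \<Rightarrow> 'w) \<Rightarrow> ('g \<Rightarrow> 'w \<Rightarrow> 'w) \<Rightarrow> bool" where
  "equivalent_act scale bracket scaleV R scaleW T \<longleftrightarrow>
     (\<exists>\<Omega>. lie_automorphism scale bracket \<Omega> \<and> isomorphic_act scaleW T scaleV (R \<circ> \<Omega>))"


section \<open>Free vector spaces\<close>

text \<open>The vector space over \<open>'a\<close> with basis \<open>'b\<close> is \<open>'b \<Rightarrow>\<^sub>0 'a\<close>. The Heisenberg
  algebra and the polynomial algebra (with basis the monomials) are both of this form.\<close>

definition scale_pm :: "'a::field \<Rightarrow> ('b \<Rightarrow>\<^sub>0 'a) \<Rightarrow> ('b \<Rightarrow>\<^sub>0 'a)" where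
  "scale_pm c f = Poly_Mapping.map ((*) c) f"

lemma lookup_scale_pm [simp]: "Poly_Mapping.lookup (scale_pm c f) k = c * Poly_Mapping.lookup f k"
  by (simp add: scale_pm_def Poly_Mapping.map.rep_eq when_def)

lemma vector_space_scale_pm: "vector_space (scale_pm :: 'a::field \<Rightarrow> ('b \<Rightarrow>\<^sub>0 'a) \<Rightarrow> _)"
  by unfold_locales (auto intro!: poly_mapping_eqI simp: lookup_add algebra_simps)


section \<open>The Heisenberg algebra\<close>

text \<open>The number \<open>n \<ge> 1\<close> is \<open>CARD('n)\<close>, where \<open>'n::finite\<close> is the type of indices.\<close>

datatype 'n heis_basis = X 'n | Y 'n | Z

type_synonym ('n, 'a) heisenberg = "'n heis_basis \<Rightarrow>\<^sub>0 'a"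

fun bracket_basis :: "'n heis_basis \<Rightarrow> 'n heis_basis \<Rightarrow> ('n, 'a::field) heisenberg" where
  "bracket_basis (X i) (Y j) = (if i = j then Poly_Mapping.single Z 1 else 0)"
| "bracket_basis (Y i) (X j) = (if i = j then - Poly_Mapping.single Z 1 else 0)"
| "bracket_basis _ _ = 0"

definition heis_bracket ::
  "('n, 'a::field) heisenberg \<Rightarrow> ('n, 'a) heisenberg \<Rightarrow> ('n, 'a) heisenberg" where
  "heis_bracket u v =
     (\<Sum>b\<in>Poly_Mapping.keys u. \<Sum>c\<in>Poly_Mapping.keys v.
        scale_pm (Poly_Mapping.lookup u b * Poly_Mapping.lookup v c) (bracket_basis b c))"

lemma heis_bracket_single:
  "heis_bracket (Poly_Mapping.single b 1) (Poly_Mapping.single c 1) =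
     (bracket_basis b c :: ('n, 'a::field) heisenberg)"
  by (auto simp: heis_bracket_def intro!: poly_mapping_eqI)


section \<open>The polynomial module\<close>

type_synonym ('n, 'a) mpoly = "('n \<Rightarrow>\<^sub>0 nat) \<Rightarrow>\<^sub>0 'a"

definition Var :: "'n \<Rightarrow> ('n, 'a::field) mpoly" where
  "Var i = Poly_Mapping.single (Poly_Mapping.single i 1) 1"

text \<open>Subtraction of exponents truncates only for monomials not involving the variable
  \<open>i\<close>, which have coefficient \<open>0\<close> below.\<close>

definition partial_deriv :: "'n \<Rightarrow> ('n, 'a::field) mpoly \<Rightarrow> ('n, 'a) mpoly" where
  "partial_deriv i f =
     (\<Sum>m\<in>Poly_Mapping.keys f.
        Poly_Mapping.single (m - Poly_Mapping.single i 1)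
          (of_nat (Poly_Mapping.lookup m i) * Poly_Mapping.lookup f m))"

fun poly_act_basis ::
  "'a::field \<Rightarrow> ('n \<Rightarrow> 'a) \<Rightarrow> ('n \<Rightarrow> 'a) \<Rightarrow> 'n heis_basis \<Rightarrow> ('n, 'a) mpoly \<Rightarrow> ('n, 'a) mpoly" where
  "poly_act_basis \<alpha> \<beta> \<gamma> Z f = scale_pm \<alpha> f"
| "poly_act_basis \<alpha> \<beta> \<gamma> (X i) f = scale_pm (\<beta> i) f + scale_pm \<alpha> (partial_deriv i f)"
| "poly_act_basis \<alpha> \<beta> \<gamma> (Y i) f = scale_pm (\<gamma> i) f + Var i * f"

definition poly_act ::
  "'a::field \<Rightarrow> ('n \<Rightarrow> 'a) \<Rightarrow> ('n \<Rightarrow> 'a) \<Rightarrow>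
   ('n, 'a) heisenberg \<Rightarrow> ('n, 'a) mpoly \<Rightarrow> ('n, 'a) mpoly" where
  "poly_act \<alpha> \<beta> \<gamma> u f =
     (\<Sum>b\<in>Poly_Mapping.keys u. scale_pm (Poly_Mapping.lookup u b) (poly_act_basis \<alpha> \<beta> \<gamma> b f))"

lemma poly_act_single:
  "poly_act \<alpha> \<beta> \<gamma> (Poly_Mapping.single b 1) f = poly_act_basis \<alpha> \<beta> \<gamma> b f"
  by (auto simp: poly_act_def intro!: poly_mapping_eqI)


section \<open>The truncated polynomial module\<close>

definition ideal_generated :: "'r::comm_ring_1 set \<Rightarrow> 'r set" where
  "ideal_generated S = module.span (*) S"

interpretation ring_module: module "(*) :: 'r::comm_ring_1 \<Rightarrow> 'r \<Rightarrow> 'r"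
  by unfold_locales (auto simp: algebra_simps)

definition power_ideal :: "nat \<Rightarrow> ('n, 'a::field) mpoly set" where
  "power_ideal p = ideal_generated (range (\<lambda>i. Var i ^ p))"

lemma power_ideal_0: "0 \<in> power_ideal p"
  and power_ideal_add: "f \<in> power_ideal p \<Longrightarrow> g \<in> power_ideal p \<Longrightarrow> f + g \<in> power_ideal p"
  and power_ideal_diff: "f \<in> power_ideal p \<Longrightarrow> g \<in> power_ideal p \<Longrightarrow> f - g \<in> power_ideal p"
  and power_ideal_uminus: "f \<in> power_ideal p \<Longrightarrow> - f \<in> power_ideal p"
  by (simp_all add: power_ideal_def ideal_generated_def ring_module.span_zero
      ring_module.span_add ring_module.span_diff ring_module.span_neg)

lemma power_ideal_scale: "f \<in> power_ideal p \<Longrightarrow> scale_pm c f \<in> power_ideal p"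
  by (simp add: power_ideal_def ideal_generated_def scale_pm_def mult_map_scale_conv_mult
      ring_module.span_scale)

text \<open>The exponent is the characteristic of the coefficient field. This type is of interest
  only if this is a prime; in characteristic \<open>0\<close> it is the zero space.\<close>

quotient_type (overloaded) ('n, 'a) trunc_poly = "('n, 'a::field) mpoly" /
  "\<lambda>f g. f - g \<in> (power_ideal CHAR('a) :: ('n, 'a) mpoly set)"
proof (intro equivpI reflpI sympI transpI)
  fix f g h :: "('n, 'a) mpoly"
  show "f - f \<in> power_ideal CHAR('a)" by (simp add: power_ideal_0)
  show "g - f \<in> power_ideal CHAR('a)" if "f - g \<in> power_ideal CHAR('a)"
    using power_ideal_uminus[OF that] by simp
  show "f - h \<in> power_ideal CHAR('a)"
    if "f - g \<in> power_ideal CHAR('a)" "g - h \<in> power_ideal CHAR('a)"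
    using power_ideal_add[OF that] by simp
qed

instantiation trunc_poly :: (type, field) ab_group_add
begin

lift_definition zero_trunc_poly :: "('a, 'b) trunc_poly" is 0 .

lift_definition plus_trunc_poly :: "('a, 'b) trunc_poly \<Rightarrow> ('a, 'b) trunc_poly \<Rightarrow> ('a, 'b) trunc_poly"
  is "(+)"
  by (subst add_diff_add) (rule power_ideal_add)

lift_definition minus_trunc_poly :: "('a, 'b) trunc_poly \<Rightarrow> ('a, 'b) trunc_poly \<Rightarrow> ('a, 'b) trunc_poly"
  is "(-)"
proof -
  fix f f' g g' :: "('a, 'b) mpoly"
  assume "f - f' \<in> power_ideal CHAR('b)" "g - g' \<in> power_ideal CHAR('b)"
  moreover have "f - g - (f' - g') = (f - f') - (g - g')" by simp
  ultimately show "f - g - (f' - g') \<in> power_ideal CHAR('b)" by (metis power_ideal_diff)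
qed

lift_definition uminus_trunc_poly :: "('a, 'b) trunc_poly \<Rightarrow> ('a, 'b) trunc_poly" is uminus
proof -
  fix f g :: "('a, 'b) mpoly"
  assume "f - g \<in> power_ideal CHAR('b)"
  moreover have "- f - - g = - (f - g)" by simp
  ultimately show "- f - - g \<in> power_ideal CHAR('b)" by (metis power_ideal_uminus)
qed

instance
  by standard (transfer, simp add: algebra_simps power_ideal_0)+

end

lift_definition scale_trunc :: "'a::field \<Rightarrow> ('n, 'a) trunc_poly \<Rightarrow> ('n, 'a) trunc_poly"
  is scale_pm
proof -
  fix c and f g :: "('n, 'a) mpoly"
  assume "f - g \<in> power_ideal CHAR('a)"
  moreover have "scale_pm c f - scale_pm c g = scale_pm c (f - g)"
    by (rule poly_mapping_eqI) (simp add: lookup_minus algebra_simps)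
  ultimately show "scale_pm c f - scale_pm c g \<in> power_ideal CHAR('a)"
    by (simp add: power_ideal_scale)
qed

definition trunc_class :: "('n, 'a::field) mpoly \<Rightarrow> ('n, 'a) trunc_poly" where
  "trunc_class f = abs_trunc_poly f"

text \<open>The induced action, computed on a representative of the class. Its independence of the
  representative amounts to the invariance of the ideal, and is not built into the definition.\<close>

definition trunc_act ::
  "'a::field \<Rightarrow> ('n \<Rightarrow> 'a) \<Rightarrow> ('n \<Rightarrow> 'a) \<Rightarrow>
   ('n, 'a) heisenberg \<Rightarrow> ('n, 'a) trunc_poly \<Rightarrow> ('n, 'a) trunc_poly" where
  "trunc_act \<alpha> \<beta> \<gamma> u v = trunc_class (poly_act \<alpha> \<beta> \<gamma> u (rep_trunc_poly v))"

end

theory Submission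
  imports Defs
begin

text \<open>Commutators with the generators show that an element of the Heisenberg algebra acting as \<open>0\<close> has
  no components, since \<open>z\<close> acts by \<open>\<alpha> \<noteq> 0\<close>: this gives faithfulness. An invariant subspace is closed under
  the partial derivatives and under multiplication by the variables. As long as all exponents stay below
  the characteristic, differentiating a nonzero polynomial leads to a nonzero constant, and multiplication
  by the variables then produces everything. In characteristic \<open>p\<close> the derivatives preserve
  \<open>(X\<^sub>1\<^sup>p, \<dots>, X\<^sub>n\<^sup>p)\<close>, so the full polynomial module is reducible. The parameters are recovered from
  the quotient as the only eigenvalues of \<open>z\<close>, \<open>x\<^sub>i\<close> and \<open>y\<^sub>i\<close>, because \<open>\<partial>/\<partial>X\<^sub>i\<close> and \<open>X\<^sub>i\<close> act
  nilpotently; an automorphism of the algebra normalizes them.\<close>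

text \<open>The interpretation \<^locale>\<open>module\<close> of multiplication in the definitions makes \<open>a * (b * c) = a * b * c\<close> a
  simplification rule, which loops against \<open>mult.assoc\<close> and \<open>mult.left_commute\<close>.\<close>

declare ring_module.scale_scale [simp del]

abbreviation lookup :: "('b \<Rightarrow>\<^sub>0 'c::zero) \<Rightarrow> 'b \<Rightarrow> 'c" where "lookup \<equiv> Poly_Mapping.lookup"
abbreviation single :: "'b \<Rightarrow> 'c \<Rightarrow> ('b \<Rightarrow>\<^sub>0 'c::zero)" where "single \<equiv> Poly_Mapping.single"
abbreviation keys :: "('b \<Rightarrow>\<^sub>0 'c::zero) \<Rightarrow> 'b set" where "keys \<equiv> Poly_Mapping.keys"

section \<open>Polynomials\<close>

lemma single_0_mult: "single 0 (a * b) = single 0 a * (single 0 b :: 'b::monoid_add \<Rightarrow>\<^sub>0 'c::semiring_0)"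
  by (simp add: mult_single)

lemma single_sum: "single k (sum g S) = (\<Sum>i\<in>S. single k (g i))"
  by (induction S rule: infinite_finite_induct) (simp_all add: single_add)

lemma scale_pm_eq_mult:
  fixes f :: "'b::monoid_add \<Rightarrow>\<^sub>0 'a::field"
  shows "scale_pm c f = single 0 c * f"
  by (simp add: scale_pm_def mult_map_scale_conv_mult)

text \<open>By cancellation \<open>k + q\<close> determines \<open>q\<close>, so at most one term of
  the convolution survives, and \<open>m - k\<close> is that \<open>q\<close>.\<close>

lemma lookup_single_mult:
  fixes f :: "'b::cancel_comm_monoid_add \<Rightarrow>\<^sub>0 'c::semiring_0"
  shows "lookup (single k c * f) m = (if \<exists>q. m = k + q then c * lookup f (m - k) else 0)"
proof -
  have "lookup (single k c * f) m = c * (\<Sum>q. lookup f q when m = k + q)"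
    by (simp add: lookup_mult lookup_single when_mult)
  then show ?thesis
    by auto
qed

text \<open>Subtraction of exponents truncates, so it inverts addition only if the exponent of
  \<open>i\<close> is at least \<open>k\<close>. This turns the divisibility condition of
  \<open>lookup_single_mult\<close> into an inequality.\<close>

lemma monomial_eq_add_single_iff:
  fixes m q :: "'n \<Rightarrow>\<^sub>0 nat"
  shows "m = single i k + q \<longleftrightarrow> k \<le> lookup m i \<and> q = m - single i k"
proof
  assume "m = single i k + q"
  then show "k \<le> lookup m i \<and> q = m - single i k"
    by (auto simp: lookup_add)
next
  assume *: "k \<le> lookup m i \<and> q = m - single i k"
  show "m = single i k + q"
    by (rule poly_mapping_eqI) (use * in \<open>auto simp: lookup_add lookup_minus lookup_single when_def\<close>)
qed

lemma Var_power: "Var i ^ k = (single (single i k) 1 :: ('n, 'a::field) mpoly)"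
  by (induction k) (simp_all add: Var_def mult_single flip: single_add)

lemma lookup_Var_mult:
  "lookup (Var i * f) m = (if lookup m i = 0 then 0 else lookup f (m - single i 1))"
  unfolding Var_def lookup_single_mult by (auto simp: monomial_eq_add_single_iff)

lemma lookup_partial_deriv:
  "lookup (partial_deriv i f) m = of_nat (Suc (lookup m i)) * lookup f (m + single i 1)"
proof -
  \<comment> \<open>A monomial without the variable \<open>i\<close> is unchanged by the truncated
    subtraction, but its factor \<open>of_nat 0\<close> vanishes. Any other \<open>k\<close> sent to
    \<open>m\<close> must be \<open>m + single i 1\<close>.\<close>
  have eq: "(of_nat (lookup k i) * lookup f k when k - single i 1 = m)
      = (if k = m + single i 1 then of_nat (Suc (lookup m i)) * lookup f (m + single i 1) else 0)" for k
  proof (cases "lookup k i = 0")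
    case True
    then show ?thesis by (auto simp: lookup_add)
  next
    case False
    then have "k - single i 1 = m \<longleftrightarrow> k = m + single i 1"
      using monomial_eq_add_single_iff[of k i 1 m] by (auto simp: add.commute)
    then show ?thesis by (auto simp: lookup_add)
  qed
  have "lookup (partial_deriv i f) m
      = (\<Sum>k\<in>keys f. of_nat (lookup k i) * lookup f k when k - single i 1 = m)"
    by (simp add: partial_deriv_def lookup_sum lookup_single)
  also have "\<dots> = of_nat (Suc (lookup m i)) * lookup f (m + single i 1)"
    unfolding eq by (simp add: in_keys_iff)
  finally show ?thesis .
qed

lemma lookup_const_mult [simp]:
  fixes f :: "'b::monoid_add \<Rightarrow>\<^sub>0 'a::field"
  shows "lookup (single 0 c * f) m = c * lookup f m"
  by (simp flip: scale_pm_eq_mult)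

lemma partial_deriv_add: "partial_deriv i (f + g) = partial_deriv i f + partial_deriv i g"
  by (rule poly_mapping_eqI) (simp add: lookup_partial_deriv lookup_add algebra_simps)

lemma partial_deriv_const_mult: "partial_deriv i (single 0 c * f) = single 0 c * partial_deriv i f"
  by (rule poly_mapping_eqI) (simp add: lookup_partial_deriv mult.left_commute del: of_nat_Suc)

lemma partial_deriv_0 [simp]: "partial_deriv i 0 = 0"
  by (simp add: partial_deriv_def)

lemma partial_deriv_sum: "partial_deriv i (sum g S) = (\<Sum>s\<in>S. partial_deriv i (g s))"
  by (induction S rule: infinite_finite_induct) (simp_all add: partial_deriv_add)

lemma partial_deriv_commute: "partial_deriv i (partial_deriv j f) = partial_deriv j (partial_deriv i f)"
  by (rule poly_mapping_eqI) (auto simp: lookup_partial_deriv lookup_add lookup_single add_ac when_def)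

text \<open>The Leibniz rule for a factor \<open>Var j\<close>. Its first summand is the canonical
  commutation relation that lets these operators represent the Heisenberg bracket.\<close>

lemma partial_deriv_Var_mult:
  "partial_deriv i (Var j * f) = (if i = j then f else 0) + Var j * partial_deriv i f"
proof (rule poly_mapping_eqI)
  fix m :: "'a \<Rightarrow>\<^sub>0 nat"
  have "m + single i 1 - single j 1 = m - single j 1 + single i 1" if "0 < lookup m j"
    by (rule poly_mapping_eqI)
       (use that in \<open>auto simp: lookup_add lookup_minus lookup_single when_def\<close>)
  moreover have "m - single j 1 + single j 1 = m" if "0 < lookup m j"
    by (rule poly_mapping_eqI)
       (use that in \<open>auto simp: lookup_add lookup_minus lookup_single when_def\<close>)
  ultimately show "lookup (partial_deriv i (Var j * f)) m
      = lookup ((if i = j then f else 0) + Var j * partial_deriv i f) m"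
    by (cases "lookup m j") (auto simp: lookup_partial_deriv lookup_Var_mult lookup_add lookup_single
        lookup_minus distrib_right)
qed

section \<open>Linear forms and derivations with constant coefficients\<close>

definition lin_form :: "('n::finite \<Rightarrow> 'a) \<Rightarrow> ('n, 'a::field) mpoly" where
  "lin_form b = (\<Sum>i\<in>UNIV. single 0 (b i) * Var i)"

text \<open>Up to scalars, a Heisenberg element acts by such a derivation through its
  \<open>X\<close> coordinates and by multiplication with a linear form through its \<open>Y\<close>
  coordinates.\<close>

definition lin_deriv :: "('n::finite \<Rightarrow> 'a) \<Rightarrow> ('n, 'a) mpoly \<Rightarrow> ('n, 'a::field) mpoly" where
  "lin_deriv a f = (\<Sum>i\<in>UNIV. single 0 (a i) * partial_deriv i f)"

lemma lin_form_add: "lin_form (\<lambda>i. a i + b i) = lin_form a + lin_form b"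
  by (simp add: lin_form_def single_add algebra_simps sum.distrib)

lemma lin_form_scale: "lin_form (\<lambda>i. c * a i) = single 0 c * lin_form a"
  by (simp only: lin_form_def sum_distrib_left single_0_mult mult.assoc)

lemma lin_deriv_add: "lin_deriv a (f + g) = lin_deriv a f + lin_deriv a g"
  by (simp add: lin_deriv_def partial_deriv_add algebra_simps sum.distrib)

lemma lin_deriv_add_left: "lin_deriv (\<lambda>i. a i + b i) f = lin_deriv a f + lin_deriv b f"
  by (simp add: lin_deriv_def single_add algebra_simps sum.distrib)

lemma lin_deriv_scale: "lin_deriv a (single 0 c * f) = single 0 c * lin_deriv a f"
  by (simp add: lin_deriv_def partial_deriv_const_mult sum_distrib_left mult.left_commute)

lemma lin_deriv_scale_left: "lin_deriv (\<lambda>i. c * a i) f = single 0 c * lin_deriv a f"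
  by (simp only: lin_deriv_def sum_distrib_left single_0_mult mult.assoc)

lemma lin_deriv_lin_deriv:
  "lin_deriv a (lin_deriv b f)
    = (\<Sum>i\<in>UNIV. \<Sum>j\<in>UNIV. single 0 (a i) * (single 0 (b j) * partial_deriv i (partial_deriv j f)))"
  by (simp add: lin_deriv_def partial_deriv_sum partial_deriv_const_mult sum_distrib_left)

lemma lin_deriv_commute: "lin_deriv a (lin_deriv b f) = lin_deriv b (lin_deriv a f)"
  unfolding lin_deriv_lin_deriv
  by (subst sum.swap, intro sum.cong refl) (simp add: partial_deriv_commute mult.left_commute)

text \<open>The Leibniz rule summed over all coordinates: the commutator of a derivation along
  \<open>a\<close> with multiplication by the form \<open>b\<close> is the scalar pairing of
  \<open>a\<close> and \<open>b\<close>.\<close>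

lemma lin_deriv_lin_form_mult:
  "lin_deriv a (lin_form b * f) = single 0 (\<Sum>i\<in>UNIV. a i * b i) * f + lin_form b * lin_deriv a f"
proof -
  have pd: "partial_deriv i (lin_form b * f) = single 0 (b i) * f + lin_form b * partial_deriv i f" for i
    by (simp add: lin_form_def sum_distrib_right partial_deriv_sum partial_deriv_const_mult mult.assoc
        partial_deriv_Var_mult distrib_left sum.distrib if_distrib[of "(*) _"] cong: if_cong)
  have "lin_deriv a (lin_form b * f) = (\<Sum>i\<in>UNIV. single 0 (a i * b i)) * f
      + (\<Sum>i\<in>UNIV. lin_form b * (single 0 (a i) * partial_deriv i f))"
    unfolding lin_deriv_def pd
    by (simp only: distrib_left sum.distrib sum_distrib_left sum_distrib_right single_0_mult mult_ac)
  then show ?thesis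
    by (simp add: lin_deriv_def single_sum sum_distrib_left)
qed

section \<open>The Heisenberg algebra and its action on polynomials\<close>

lemma UNIV_heis_basis: "(UNIV :: 'n heis_basis set) = insert Z (X ` UNIV \<union> Y ` UNIV)"
proof -
  have "b \<in> insert Z (X ` UNIV \<union> Y ` UNIV)" for b :: "'n heis_basis"
    by (cases b) auto
  then show ?thesis by blast
qed

instance heis_basis :: (finite) finite
  by standard (simp add: UNIV_heis_basis)

lemma sum_heis_basis:
  fixes f :: "'n::finite heis_basis \<Rightarrow> 'c::comm_monoid_add"
  shows "(\<Sum>b\<in>UNIV. f b) = f Z + (\<Sum>i\<in>UNIV. f (X i)) + (\<Sum>i\<in>UNIV. f (Y i))"
proof -
  have "(\<Sum>b\<in>UNIV. f b) = f Z + sum f (X ` UNIV \<union> Y ` UNIV)"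
    unfolding UNIV_heis_basis by (subst sum.insert) auto
  also have "sum f (X ` UNIV \<union> Y ` UNIV) = sum f (X ` UNIV) + sum f (Y ` UNIV)"
    by (rule sum.union_disjoint) auto
  also have "sum f (X ` UNIV) = (\<Sum>i\<in>UNIV. f (X i))"
    by (subst sum.reindex) (auto intro: injI)
  also have "sum f (Y ` UNIV) = (\<Sum>i\<in>UNIV. f (Y i))"
    by (subst sum.reindex) (auto intro: injI)
  finally show ?thesis by (simp add: add.assoc)
qed

text \<open>Supports vary when elements are added; sums over the whole finite basis make linearity
  visible.\<close>

lemma sum_keys_eq_sum_UNIV:
  fixes u :: "'b::finite \<Rightarrow>\<^sub>0 'c::zero"
  assumes "\<And>b. lookup u b = 0 \<Longrightarrow> f b = 0"
  shows "sum f (keys u) = sum f UNIV"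
  by (rule sum.mono_neutral_left) (use assms in \<open>auto simp: in_keys_iff\<close>)

lemma scale_pm_0 [simp]: "scale_pm c 0 = 0"
  by (simp add: poly_mapping_eqI)

lemma scale_pm_single: "scale_pm c (single k d) = single k (c * d)"
  by (simp add: poly_mapping_eqI lookup_single mult_when)

lemma scale_pm_uminus: "scale_pm c (- f) = - scale_pm c f"
  by (simp add: poly_mapping_eqI)

text \<open>The sum is the standard symplectic form in the \<open>X\<close> and \<open>Y\<close>
  coordinates. As every bracket is a multiple of the central \<open>Z\<close>, nested brackets
  vanish and the Jacobi identity becomes trivial.\<close>

lemma heis_bracket_eq:
  fixes u v :: "('n::finite, 'a::field) heisenberg"
  shows "heis_bracket u v
    = single Z (\<Sum>i\<in>UNIV. lookup u (X i) * lookup v (Y i) - lookup u (Y i) * lookup v (X i))"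
proof -
  have "heis_bracket u v = (\<Sum>b\<in>UNIV. \<Sum>c\<in>UNIV.
      scale_pm (lookup u b * lookup v c) (bracket_basis b c))"
    unfolding heis_bracket_def
    by (subst sum_keys_eq_sum_UNIV, auto intro!: poly_mapping_eqI simp: lookup_sum
        sum_keys_eq_sum_UNIV)
  then show ?thesis
    by (simp add: sum_heis_basis if_distrib[of "scale_pm _"] scale_pm_single scale_pm_uminus single_sum
        single_diff sum_subtractf sum_negf cong: if_cong)
qed

section \<open>The Lie algebra axioms and the module axioms for polynomials\<close>

lemma linear_scale_pm_iff:
  "Vector_Spaces.linear scale_pm scale_pm f \<longleftrightarrow>
     (\<forall>x y. f (x + y) = f x + f y) \<and> (\<forall>c x. f (scale_pm c x) = scale_pm c (f x))"
  by (simp add: Vector_Spaces.linear_iff vector_space_scale_pm)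

lemma lie_algebra_heisenberg:
  "lie_algebra scale_pm (heis_bracket :: ('n::finite, 'a::field) heisenberg \<Rightarrow> _)"
proof (intro lie_algebra.intro vector_space_scale_pm lie_algebra_axioms.intro)
  fix u v w :: "('n, 'a) heisenberg"
  show "heis_bracket u u = 0"
    by (simp add: heis_bracket_eq mult.commute)
  show "heis_bracket u (heis_bracket v w) + heis_bracket v (heis_bracket w u)
      + heis_bracket w (heis_bracket u v) = 0"
    by (simp add: heis_bracket_eq lookup_single)
  show "Vector_Spaces.linear scale_pm scale_pm (\<lambda>u. heis_bracket u v)"
    "Vector_Spaces.linear scale_pm scale_pm (heis_bracket u)"
    by (auto simp: linear_scale_pm_iff heis_bracket_eq lookup_add lookup_single when_def sum_subtractf
        sum.distrib sum_distrib_left algebra_simps intro!: poly_mapping_eqI)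
qed

text \<open>Splits the action into a scalar, a derivation and a multiplication operator, the form in
  which commutators are computed.\<close>

lemma poly_act_eq:
  fixes u :: "('n::finite, 'a::field) heisenberg"
  shows "poly_act \<alpha> \<beta> \<gamma> u f
    = single 0 (lookup u Z * \<alpha> + (\<Sum>i\<in>UNIV. lookup u (X i) * \<beta> i) + (\<Sum>i\<in>UNIV. lookup u (Y i) * \<gamma> i)) * f
      + single 0 \<alpha> * lin_deriv (\<lambda>i. lookup u (X i)) f + lin_form (\<lambda>i. lookup u (Y i)) * f"
proof -
  have "poly_act \<alpha> \<beta> \<gamma> u f = (\<Sum>b\<in>UNIV. scale_pm (lookup u b) (poly_act_basis \<alpha> \<beta> \<gamma> b f))"
    unfolding poly_act_def by (rule sum_keys_eq_sum_UNIV) (simp add: scale_pm_eq_mult)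
  then show ?thesis
    by (simp only: sum_heis_basis poly_act_basis.simps scale_pm_eq_mult lin_deriv_def lin_form_def
        single_add single_0_mult single_sum distrib_left distrib_right sum_distrib_left sum_distrib_right sum.distrib ac_simps)
qed

lemma linear_poly_act_left:
  "Vector_Spaces.linear scale_pm scale_pm (\<lambda>u :: ('n::finite, 'a::field) heisenberg. poly_act \<alpha> \<beta> \<gamma> u f)"
  unfolding linear_scale_pm_iff
proof (intro conjI allI)
  fix c :: 'a and u v :: "('n, 'a) heisenberg"
  show "poly_act \<alpha> \<beta> \<gamma> (u + v) f = poly_act \<alpha> \<beta> \<gamma> u f + poly_act \<alpha> \<beta> \<gamma> v f"
    by (simp add: poly_act_eq lookup_add lin_deriv_add_left lin_form_add single_add single_sum
        sum.distrib distrib_right distrib_left)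
  show "poly_act \<alpha> \<beta> \<gamma> (scale_pm c u) f = scale_pm c (poly_act \<alpha> \<beta> \<gamma> u f)"
    by (intro poly_mapping_eqI) (simp add: poly_act_eq lin_deriv_scale_left lin_form_scale lookup_add
        mult.assoc mult.left_commute[of \<alpha> c] distrib_left distrib_right sum_distrib_left sum_distrib_right)
qed

lemma linear_poly_act_right:
  fixes u :: "('n::finite, 'a::field) heisenberg"
  shows "Vector_Spaces.linear scale_pm scale_pm (poly_act \<alpha> \<beta> \<gamma> u)"
  by (auto simp: linear_scale_pm_iff poly_act_eq scale_pm_eq_mult lin_deriv_add lin_deriv_scale
      distrib_left distrib_right mult.left_commute)

text \<open>Scalars commute with everything, derivations with each other and multiplications with
  each other. Only the commutators of a derivation with a linear form survive, and they add up to
  \<alpha> times the symplectic form.\<close>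

lemma poly_act_bracket:
  fixes u w :: "('n::finite, 'a::field) heisenberg"
  shows "poly_act \<alpha> \<beta> \<gamma> (heis_bracket u w) f
    = poly_act \<alpha> \<beta> \<gamma> u (poly_act \<alpha> \<beta> \<gamma> w f) - poly_act \<alpha> \<beta> \<gamma> w (poly_act \<alpha> \<beta> \<gamma> u f)"
proof -
  \<comment> \<open>The bracket is a multiple of \<open>Z\<close>, so its derivation and
    multiplication parts vanish.\<close>
  have lhs: "poly_act \<alpha> \<beta> \<gamma> (heis_bracket u w) f
      = single 0 \<alpha> * single 0 (\<Sum>i\<in>UNIV. lookup u (X i) * lookup w (Y i)) * f
        - single 0 \<alpha> * single 0 (\<Sum>i\<in>UNIV. lookup u (Y i) * lookup w (X i)) * f"
    by (simp add: poly_act_eq heis_bracket_eq lookup_single lookup_minus lin_deriv_def lin_form_def sum_subtractf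
        single_diff right_diff_distrib left_diff_distrib mult.commute[of _ \<alpha>] flip: single_0_mult)
  show ?thesis
    unfolding lhs unfolding poly_act_eq
    by (simp only: lin_deriv_add lin_deriv_scale lin_deriv_lin_form_mult
        lin_deriv_commute[of "\<lambda>i. lookup u (X i)" "\<lambda>i. lookup w (X i)"])
       (simp add: algebra_simps)
qed

lemma lie_module_poly_act:
  "lie_module scale_pm (heis_bracket :: ('n::finite, 'a::field) heisenberg \<Rightarrow> _) scale_pm (poly_act \<alpha> \<beta> \<gamma>)"
  by (intro lie_module.intro lie_algebra_heisenberg vector_space_scale_pm lie_module_axioms.intro
      linear_poly_act_left linear_poly_act_right poly_act_bracket)

lemma poly_mapping_eq_sum_single: "f = (\<Sum>k\<in>keys f. single k (lookup f k))"
  by (rule poly_mapping_eqI) (simp add: lookup_sum lookup_single when_def in_keys_iff)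

section \<open>Faithfulness\<close>

text \<open>Stated for any nonzero module on which \<open>Z\<close> acts by a nonzero scalar, so
  that it serves both the polynomial module and its quotient.\<close>

lemma heisenberg_module_faithful:
  fixes act :: "('n::finite, 'a::field) heisenberg \<Rightarrow> 'v::ab_group_add \<Rightarrow> 'v"
  assumes "lie_module scale_pm heis_bracket scaleV act"
    and act_Z: "\<And>v. act (single Z 1) v = scaleV \<alpha> v"
    and "\<alpha> \<noteq> 0" and "v \<noteq> (0 :: 'v)"
  shows "faithful_act act"
proof -
  interpret lie_module scale_pm heis_bracket scaleV act by fact
  have act_single_Z: "act (single Z s) x = scaleV (s * \<alpha>) x" for s x
  proof -
    have "single Z s = scale_pm s (single Z 1)"
      by (simp add: scale_pm_single)
    then show ?thesis
      using linear_act_left[of x] act_Z by (metis Vector_Spaces.linear_iff V.scale_scale)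
  qed
  have act_0: "act x 0 = 0" for x
    using linear_act_right[of x] by (metis Vector_Spaces.linear_iff V.scale_zero_left)
  show ?thesis
    unfolding faithful_act_def
  proof (rule injI)
    fix u w
    assume uw: "act u = act w"
    define d where "d = u - w"
    have act_d: "act d x = 0" for x
    proof -
      have "act (d + w) x = act d x + act w x"
        using linear_act_left[of x] by (simp add: Vector_Spaces.linear_iff)
      then show ?thesis by (simp add: d_def uw)
    qed
    \<comment> \<open>A bracket with \<open>d\<close> acts as 0 because \<open>d\<close> does; being
      a multiple of \<open>Z\<close>, it can annihilate \<open>v\<close> only if it is 0.\<close>
    have bracket_0: "heis_bracket d e = 0" for e
    proof -
      obtain s where s: "heis_bracket d e = single Z s"
        by (simp add: heis_bracket_eq)
      have "act (heis_bracket d e) v = 0"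
        by (simp add: act_bracket act_d act_0)
      then show ?thesis
        using assms(3,4) by (simp add: s act_single_Z)
    qed
    \<comment> \<open>Bracketing with a basis vector \<open>Y i\<close> or \<open>X i\<close>
      isolates, up to sign, the coordinate of \<open>d\<close> at \<open>X i\<close> or
      \<open>Y i\<close>.\<close>
    have "lookup (heis_bracket d (single (Y i) 1)) Z = 0" "lookup (heis_bracket d (single (X i) 1)) Z = 0" for i
      by (simp_all add: bracket_0)
    then have XY: "lookup d (X i) = 0" "lookup d (Y i) = 0" for i
      by (simp_all add: heis_bracket_eq lookup_single when_def sum_negf if_distrib[of "(*) _"] cong: if_cong)
    then have "d = single Z (lookup d Z)"
      by (intro poly_mapping_eqI) (metis heis_basis.exhaust lookup_single_eq lookup_single_not_eq)
    then have "lookup d Z = 0"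
      using act_d[of v] assms(3,4) by (metis act_single_Z V.scale_eq_0_iff mult_eq_0_iff)
    with XY have "d = 0"
      by (metis heis_basis.exhaust lookup_zero poly_mapping_eqI)
    then show "u = w" by (simp add: d_def)
  qed
qed

section \<open>Invariant subspaces\<close>

interpretation poly: vector_space "scale_pm :: 'a::field \<Rightarrow> ('b \<Rightarrow>\<^sub>0 'a) \<Rightarrow> _"
  by (rule vector_space_scale_pm)

text \<open>Scalar operators preserve every subspace and \<alpha> can be divided out, so invariance
  does not depend on the parameters.\<close>

lemma invariant_subspace_poly_act_iff:
  fixes W :: "('n::finite, 'a::field) mpoly set"
  assumes "\<alpha> \<noteq> 0"
  shows "invariant_subspace scale_pm (poly_act \<alpha> \<beta> \<gamma>) W \<longleftrightarrow>
    poly.subspace W \<and> (\<forall>i. \<forall>f\<in>W. partial_deriv i f \<in> W \<and> Var i * f \<in> W)"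
proof (intro iffI conjI allI ballI)
  assume inv: "invariant_subspace scale_pm (poly_act \<alpha> \<beta> \<gamma>) W"
  then show sub: "poly.subspace W" by (simp add: invariant_subspace_def)
  fix i f
  assume f: "f \<in> W"
  have act: "poly_act_basis \<alpha> \<beta> \<gamma> b f \<in> W" for b
    using inv f unfolding invariant_subspace_def by (metis poly_act_single)
  have "scale_pm (1 / \<alpha>) (poly_act_basis \<alpha> \<beta> \<gamma> (X i) f - scale_pm (\<beta> i) f) = partial_deriv i f"
    using assms by simp
  then show "partial_deriv i f \<in> W"
    using sub act f by (metis poly.subspace_diff poly.subspace_scale)
  have "poly_act_basis \<alpha> \<beta> \<gamma> (Y i) f - scale_pm (\<gamma> i) f = Var i * f"
    by simp
  then show "Var i * f \<in> W"
    using sub act f by (metis poly.subspace_diff poly.subspace_scale)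
next
  assume W: "poly.subspace W \<and> (\<forall>i. \<forall>f\<in>W. partial_deriv i f \<in> W \<and> Var i * f \<in> W)"
  then have "poly_act_basis \<alpha> \<beta> \<gamma> b f \<in> W" if "f \<in> W" for b f
    using that by (cases b) (auto intro!: poly.subspace_add poly.subspace_scale)
  then show "invariant_subspace scale_pm (poly_act \<alpha> \<beta> \<gamma>) W"
    using W by (auto simp: invariant_subspace_def poly_act_def intro!: poly.subspace_sum poly.subspace_scale)
qed

definition mono_degree :: "('n::finite \<Rightarrow>\<^sub>0 nat) \<Rightarrow> nat" where
  "mono_degree m = (\<Sum>i\<in>UNIV. lookup m i)"

lemma mono_degree_add_single [simp]: "mono_degree (m + single i k) = mono_degree m + k"
  by (simp add: mono_degree_def lookup_add lookup_single when_def sum.distrib)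

lemma minus_single_add_single:
  fixes m :: "'n \<Rightarrow>\<^sub>0 nat"
  shows "k \<le> lookup m i \<Longrightarrow> m - single i k + single i k = m"
  by (metis add.commute monomial_eq_add_single_iff)

lemma monomial_neq_0E:
  fixes m :: "'n \<Rightarrow>\<^sub>0 nat"
  assumes "m \<noteq> 0"
  obtains i where "lookup m i > 0"
  using assms by (metis lookup_zero neq0_conv poly_mapping_eqI)

text \<open>Each nonconstant monomial is a variable times one of lower degree, so induction on the
  degree reaches all monomials from a nonzero constant.\<close>

lemma subspace_eq_UNIV:
  fixes W :: "('n::finite, 'a::field) mpoly set"
  assumes sub: "poly.subspace W" and mult: "\<And>i f. f \<in> W \<Longrightarrow> Var i * f \<in> W"
    and "c \<noteq> 0" "single 0 c \<in> W"
  shows "W = UNIV"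
proof -
  have "single m d \<in> W" for m d
  proof (induction "mono_degree m" arbitrary: m rule: less_induct)
    case less
    show ?case
    proof (cases "m = 0")
      case True
      have "scale_pm (d / c) (single 0 c) = (single 0 d :: ('n, 'a) mpoly)"
        using \<open>c \<noteq> 0\<close> by (simp add: scale_pm_single)
      then show ?thesis
        using True sub \<open>single 0 c \<in> W\<close> by (metis poly.subspace_scale)
    next
      case False
      then obtain i where i: "lookup m i > 0" by (rule monomial_neq_0E)
      then have m: "m - single i 1 + single i 1 = m"
        by (intro minus_single_add_single) simp
      then have "mono_degree (m - single i 1) < mono_degree m"
        by (metis mono_degree_add_single less_add_one)
      then have "Var i * single (m - single i 1) d \<in> W"
        by (intro mult less)
      then show ?thesis
        using m by (simp add: Var_def mult_single add.commute)
    qed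
  qed
  then have "f \<in> W" for f
    by (subst poly_mapping_eq_sum_single) (intro poly.subspace_sum sub)
  then show ?thesis by blast
qed

text \<open>Differentiating with respect to a variable that occurs lowers the degree, and the exponents
  below the characteristic do not vanish in the field.\<close>

lemma derivatives_contain_constant:
  fixes W :: "('n::finite, 'a::field) mpoly set"
  assumes deriv: "\<And>i f. f \<in> W \<Longrightarrow> partial_deriv i f \<in> W"
    and "f \<in> W" "f \<noteq> 0"
    and "\<And>m i. m \<in> keys f \<Longrightarrow> CHAR('a) = 0 \<or> lookup m i < CHAR('a)"
  shows "\<exists>c. c \<noteq> 0 \<and> single 0 c \<in> W"
proof -
  \<comment> \<open>The induction runs over an upper bound for the degrees of the monomials of
    \<open>f\<close>; each derivative lowers the bound by 1.\<close>
  obtain d where "\<And>m. m \<in> keys f \<Longrightarrow> mono_degree m \<le> d"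
    using finite_imageI[OF finite_keys, of mono_degree f] by (metis Max_ge imageI)
  then show ?thesis using assms(2-4)
  proof (induction d arbitrary: f rule: less_induct)
    case (less d)
    show ?case
    proof (cases "keys f \<subseteq> {0}")
      case True
      then have "f = single 0 (lookup f 0)"
        by (intro poly_mapping_eqI) (auto simp: lookup_single when_def in_keys_iff)
      then show ?thesis
        using less.prems by (metis single_zero)
    next
      case False
      then obtain m where m: "m \<in> keys f" "m \<noteq> 0" by blast
      then obtain i where i: "lookup m i > 0" by (metis monomial_neq_0E)
      then have mi: "m - single i 1 + single i 1 = m"
        by (intro minus_single_add_single) simp
      have keys: "k + single i 1 \<in> keys f" if "k \<in> keys (partial_deriv i f)" for k
        using that by (auto simp: in_keys_iff lookup_partial_deriv)
      \<comment> \<open>A positive number below the characteristic is not divisible by it, and in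
        characteristic 0 no positive number is.\<close>
      have "\<not> CHAR('a) dvd lookup m i"
        using less.prems(4)[OF m(1), of i] i by (auto dest: dvd_imp_le)
      then have "lookup (partial_deriv i f) (m - single i 1) \<noteq> 0"
        using m i mi by (simp add: lookup_partial_deriv lookup_minus in_keys_iff of_nat_eq_0_iff_char_dvd
            del: of_nat_Suc)
      then have nz: "partial_deriv i f \<noteq> 0" by auto
      have d: "mono_degree m \<le> d" "mono_degree m > 0"
        using less.prems(1) m mi by (simp, metis add_is_0 mono_degree_add_single not_gr0 zero_neq_one)
      show ?thesis
      proof (rule less.IH[of "d - 1" "partial_deriv i f"])
        show "d - 1 < d" using d by simp
        show "mono_degree k \<le> d - 1" if "k \<in> keys (partial_deriv i f)" for k
          using less.prems(1)[OF keys[OF that]] by simp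
        show "CHAR('a) = 0 \<or> lookup k j < CHAR('a)" if "k \<in> keys (partial_deriv i f)" for k j
          using less.prems(4)[OF keys[OF that], of j] by (auto simp: lookup_add)
      qed (use less.prems deriv nz in auto)
    qed
  qed
qed

text \<open>The exponent bound is asked of a single element of \<open>W\<close>: any nonzero
  polynomial will do in characteristic 0, a reduced representative in characteristic p.\<close>

lemma invariant_subspace_eq_UNIV:
  fixes W :: "('n::finite, 'a::field) mpoly set"
  assumes "\<alpha> \<noteq> 0" "invariant_subspace scale_pm (poly_act \<alpha> \<beta> \<gamma>) W" "f \<in> W" "f \<noteq> 0"
    and "\<And>m i. m \<in> keys f \<Longrightarrow> CHAR('a) = 0 \<or> lookup m i < CHAR('a)"
  shows "W = UNIV"
proof -
  have W: "poly.subspace W" "\<And>i f. f \<in> W \<Longrightarrow> partial_deriv i f \<in> W"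
    "\<And>i f. f \<in> W \<Longrightarrow> Var i * f \<in> W"
    using assms(1,2) by (auto simp: invariant_subspace_poly_act_iff)
  obtain c where "c \<noteq> 0" "single 0 c \<in> W"
    using derivatives_contain_constant[OF W(2) assms(3-5)] by blast
  with W show ?thesis by (intro subspace_eq_UNIV)
qed

section \<open>The ideal generated by the powers of the variables\<close>

text \<open>A monomial ideal is determined coefficientwise. Multiples of \<open>Var i ^ p\<close>
  contain only monomials with exponent at least \<open>p\<close> at \<open>i\<close>; conversely,
  each monomial with such an exponent factors through \<open>Var i ^ p\<close>.\<close>

lemma mem_power_ideal_iff:
  fixes f :: "('n, 'a::field) mpoly"
  shows "f \<in> power_ideal p \<longleftrightarrow> (\<forall>m. (\<forall>i. lookup m i < p) \<longrightarrow> lookup f m = 0)"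
proof
  assume "f \<in> power_ideal p"
  then have "f \<in> ring_module.span (range (\<lambda>i. Var i ^ p))"
    by (simp add: power_ideal_def ideal_generated_def)
  then show "\<forall>m. (\<forall>i. lookup m i < p) \<longrightarrow> lookup f m = 0"
  proof (induction rule: ring_module.span_induct_alt)
    case (step c x y)
    then obtain i where x: "x = single (single i p) 1"
      by (auto simp: Var_power)
    have "lookup (c * x + y) m = 0" if "\<forall>i. lookup m i < p" for m
    proof -
      have "\<not> p \<le> lookup m i" using that by (simp add: not_le)
      then show ?thesis
        using step that
        by (simp add: x mult.commute[of c] lookup_add lookup_single_mult monomial_eq_add_single_iff)
    qed
    then show ?case by blast
  qed simp
next
  assume *: "\<forall>m. (\<forall>i. lookup m i < p) \<longrightarrow> lookup f m = 0"
  have "single k (lookup f k) \<in> ring_module.span (range (\<lambda>i. Var i ^ p))" if "k \<in> keys f" for k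
  proof -
    have "\<not> (\<forall>i. lookup k i < p)"
      using * that by (auto simp: in_keys_iff)
    then obtain i where i: "p \<le> lookup k i"
      by (auto simp: not_less)
    have "single (k - single i p) (lookup f k) * Var i ^ p \<in> ring_module.span (range (\<lambda>i. Var i ^ p))"
      by (intro ring_module.span_scale ring_module.span_base) auto
    then show ?thesis
      by (simp add: Var_power mult_single minus_single_add_single[OF i])
  qed
  then have "(\<Sum>k\<in>keys f. single k (lookup f k)) \<in> power_ideal p"
    unfolding power_ideal_def ideal_generated_def by (rule ring_module.span_sum)
  then show "f \<in> power_ideal p"
    by (simp flip: poly_mapping_eq_sum_single)
qed

lemma Var_power_in_power_ideal: "Var i ^ p \<in> power_ideal p"
  unfolding power_ideal_def ideal_generated_def by (intro ring_module.span_base) auto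

lemma invariant_power_ideal:
  fixes \<alpha> :: "'a::field" and \<beta> \<gamma> :: "'n::finite \<Rightarrow> 'a"
  assumes "\<alpha> \<noteq> 0"
  shows "invariant_subspace scale_pm (poly_act \<alpha> \<beta> \<gamma>) (power_ideal CHAR('a))"
  unfolding invariant_subspace_poly_act_iff[OF assms]
proof (intro conjI allI ballI)
  show "poly.subspace (power_ideal CHAR('a) :: ('n, 'a) mpoly set)"
    by (simp add: poly.subspace_def power_ideal_0 power_ideal_add power_ideal_scale)
  fix i :: 'n and f :: "('n, 'a) mpoly"
  assume f: "f \<in> power_ideal CHAR('a)"
  show "Var i * f \<in> power_ideal CHAR('a)"
    using f unfolding power_ideal_def ideal_generated_def by (rule ring_module.span_scale)
  have "lookup (partial_deriv i f) m = 0" if m: "\<forall>j. lookup m j < CHAR('a)" for m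
  \<comment> \<open>The coefficient at \<open>m\<close> comes from \<open>m + single i 1\<close>.
    This monomial leaves the bounded range only if its exponent at \<open>i\<close> reaches the
    characteristic, and then the factor produced by the derivative is 0.\<close>
  proof (cases "Suc (lookup m i) = CHAR('a)")
    case True
    then show ?thesis by (simp add: lookup_partial_deriv del: of_nat_Suc)
  next
    case False
    with m have "\<forall>j. lookup (m + single i 1) j < CHAR('a)"
      by (simp add: lookup_add lookup_single when_def) (metis Suc_lessI)
    with f have "lookup f (m + single i 1) = 0"
      by (simp add: mem_power_ideal_iff)
    then show ?thesis by (simp add: lookup_partial_deriv)
  qed
  then show "partial_deriv i f \<in> power_ideal CHAR('a)"
    by (simp add: mem_power_ideal_iff)
qed

section \<open>Irreducibility of the polynomial module\<close>

lemma irreducible_poly_act_iff: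
  fixes \<alpha> :: "'a::field" and \<beta> \<gamma> :: "'n::finite \<Rightarrow> 'a"
  assumes "\<alpha> \<noteq> 0"
  shows "irreducible_act scale_pm (poly_act \<alpha> \<beta> \<gamma>) \<longleftrightarrow> CHAR('a) = 0"
proof
  assume irr: "irreducible_act scale_pm (poly_act \<alpha> \<beta> \<gamma>)"
  show "CHAR('a) = 0"
  proof (rule ccontr)
    assume "CHAR('a) \<noteq> 0"
    \<comment> \<open>The ideal is proper because it misses 1, whose monomial has all exponents 0,
      and it is nonzero because it contains \<open>Var i ^ CHAR('a)\<close>.\<close>
    then have "(1 :: ('n, 'a) mpoly) \<notin> power_ideal CHAR('a)"
      by (auto simp: mem_power_ideal_iff intro!: exI[of _ 0])
    moreover have "(Var i ^ CHAR('a) :: ('n, 'a) mpoly) \<noteq> 0" for i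
      by (metis Var_power lookup_single_eq lookup_zero zero_neq_one)
    ultimately show False
      using irr invariant_power_ideal[OF assms, of \<beta> \<gamma>] Var_power_in_power_ideal
      unfolding irreducible_act_def by (metis UNIV_I singletonD)
  qed
next
  assume "CHAR('a) = 0"
  then have "W = {0} \<or> W = UNIV" if "invariant_subspace scale_pm (poly_act \<alpha> \<beta> \<gamma>) W" for W
    using invariant_subspace_eq_UNIV[OF assms that] that poly.subspace_0
    unfolding invariant_subspace_def by blast
  moreover have "(UNIV :: ('n, 'a) mpoly set) \<noteq> {0}"
    by (metis UNIV_I singletonD zero_neq_one)
  ultimately show "irreducible_act scale_pm (poly_act \<alpha> \<beta> \<gamma>)"
    unfolding irreducible_act_def by blast
qed

section \<open>The truncated module\<close>

lemma trunc_class_eq_iff: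
  fixes f g :: "('n, 'a::field) mpoly"
  shows "trunc_class f = trunc_class g \<longleftrightarrow> f - g \<in> power_ideal CHAR('a)"
  by (simp add: trunc_class_def trunc_poly.abs_eq_iff)

lemma trunc_class_rep [simp]: "trunc_class (rep_trunc_poly v) = v"
  unfolding trunc_class_def by (rule Quotient_abs_rep[OF Quotient_trunc_poly])

lemma trunc_class_cases [cases type: trunc_poly]:
  obtains f where "v = trunc_class f"
  using trunc_class_rep by metis

lemma trunc_class_0: "trunc_class 0 = 0"
  by (simp add: trunc_class_def zero_trunc_poly.abs_eq)

lemma trunc_class_add: "trunc_class (f + g) = trunc_class f + trunc_class g"
  by (simp add: trunc_class_def plus_trunc_poly.abs_eq)

lemma trunc_class_diff: "trunc_class (f - g) = trunc_class f - trunc_class g"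
  by (simp add: trunc_class_def minus_trunc_poly.abs_eq)

lemma trunc_class_scale: "trunc_class (scale_pm c f) = scale_trunc c (trunc_class f)"
  by (simp add: trunc_class_def scale_trunc.abs_eq)

lemma trunc_class_sum: "trunc_class (sum g S) = (\<Sum>s\<in>S. trunc_class (g s))"
  by (induction S rule: infinite_finite_induct) (simp_all add: trunc_class_0 trunc_class_add)

lemma trunc_class_eq_0_iff:
  fixes f :: "('n, 'a::field) mpoly"
  shows "trunc_class f = 0 \<longleftrightarrow> f \<in> power_ideal CHAR('a)"
  by (simp add: trunc_class_eq_iff flip: trunc_class_0)

lemma vector_space_scale_trunc:
  "vector_space (scale_trunc :: 'a::field \<Rightarrow> ('n, 'a) trunc_poly \<Rightarrow> _)"
proof
  fix a b :: 'a and v w :: "('n, 'a) trunc_poly"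
  obtain f g where v: "v = trunc_class f" and w: "w = trunc_class g"
    by (metis trunc_class_rep)
  show "scale_trunc a (v + w) = scale_trunc a v + scale_trunc a w"
    "scale_trunc (a + b) v = scale_trunc a v + scale_trunc b v"
    "scale_trunc a (scale_trunc b v) = scale_trunc (a * b) v"
    "scale_trunc 1 v = v"
    unfolding v w
    by (simp_all add: poly.scale_right_distrib poly.scale_left_distrib
        flip: trunc_class_add trunc_class_scale)
qed

interpretation trunc: vector_space "scale_trunc :: 'a::field \<Rightarrow> ('n, 'a) trunc_poly \<Rightarrow> _"
  by (rule vector_space_scale_trunc)

text \<open>The chosen representative differs from \<open>f\<close> by an element of the ideal,
  which the action preserves. Through this lemma, identities for polynomials descend to the
  quotient.\<close>

lemma trunc_act_trunc_class:
  fixes \<alpha> :: "'a::field" and \<beta> \<gamma> :: "'n::finite \<Rightarrow> 'a"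
  assumes "\<alpha> \<noteq> 0"
  shows "trunc_act \<alpha> \<beta> \<gamma> u (trunc_class f) = trunc_class (poly_act \<alpha> \<beta> \<gamma> u f)"
proof -
  define g where "g = rep_trunc_poly (trunc_class f)"
  have "g - f \<in> power_ideal CHAR('a)"
    by (simp add: g_def flip: trunc_class_eq_iff)
  then have "poly_act \<alpha> \<beta> \<gamma> u (g - f) \<in> power_ideal CHAR('a)"
    using invariant_power_ideal[OF assms, of \<beta> \<gamma>] by (simp add: invariant_subspace_def)
  moreover have "poly_act \<alpha> \<beta> \<gamma> u (g - f + f) = poly_act \<alpha> \<beta> \<gamma> u (g - f) + poly_act \<alpha> \<beta> \<gamma> u f"
    using linear_poly_act_right[of \<alpha> \<beta> \<gamma> u] unfolding linear_scale_pm_iff by blast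
  ultimately show ?thesis
    by (simp add: trunc_act_def trunc_class_eq_iff flip: g_def)
qed

lemma lie_module_trunc_act:
  fixes \<alpha> :: "'a::field" and \<beta> \<gamma> :: "'n::finite \<Rightarrow> 'a"
  assumes "\<alpha> \<noteq> 0"
  shows "lie_module scale_pm (heis_bracket :: ('n, 'a) heisenberg \<Rightarrow> _) scale_trunc (trunc_act \<alpha> \<beta> \<gamma>)"
proof (intro lie_module.intro lie_algebra_heisenberg vector_space_scale_trunc lie_module_axioms.intro)
  note act = trunc_act_trunc_class[OF assms, of \<beta> \<gamma>]
  fix u w :: "('n, 'a) heisenberg" and v :: "('n, 'a) trunc_poly"
  obtain f where v: "v = trunc_class f" by (rule trunc_class_cases)
  show "trunc_act \<alpha> \<beta> \<gamma> (heis_bracket u w) v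
      = trunc_act \<alpha> \<beta> \<gamma> u (trunc_act \<alpha> \<beta> \<gamma> w v) - trunc_act \<alpha> \<beta> \<gamma> w (trunc_act \<alpha> \<beta> \<gamma> u v)"
    by (simp add: v act poly_act_bracket trunc_class_diff)
  show "Vector_Spaces.linear scale_pm scale_trunc (\<lambda>u. trunc_act \<alpha> \<beta> \<gamma> u v)"
    using linear_poly_act_left[of \<alpha> \<beta> \<gamma> f]
    by (simp add: v act Vector_Spaces.linear_iff vector_space_scale_trunc trunc_class_add trunc_class_scale)
  have "trunc_act \<alpha> \<beta> \<gamma> u (trunc_class f + trunc_class g)
      = trunc_act \<alpha> \<beta> \<gamma> u (trunc_class f) + trunc_act \<alpha> \<beta> \<gamma> u (trunc_class g)"
    "trunc_act \<alpha> \<beta> \<gamma> u (scale_trunc c (trunc_class f)) = scale_trunc c (trunc_act \<alpha> \<beta> \<gamma> u (trunc_class f))"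
    for f g c
    using linear_poly_act_right[of \<alpha> \<beta> \<gamma> u]
    by (simp_all add: act Vector_Spaces.linear_iff flip: trunc_class_add trunc_class_scale)
  then show "Vector_Spaces.linear scale_trunc scale_trunc (trunc_act \<alpha> \<beta> \<gamma> u)"
    unfolding Vector_Spaces.linear_iff by (metis trunc_class_rep vector_space_scale_trunc)
qed

lemma trunc_act_single:
  fixes \<alpha> :: "'a::field" and \<beta> \<gamma> :: "'n::finite \<Rightarrow> 'a"
  assumes "\<alpha> \<noteq> 0"
  shows "trunc_act \<alpha> \<beta> \<gamma> (single b 1) (trunc_class f) = trunc_class (poly_act_basis \<alpha> \<beta> \<gamma> b f)"
  by (simp add: trunc_act_trunc_class[OF assms] poly_act_single)

lemma trunc_act_Z:
  fixes \<alpha> :: "'a::field" and \<beta> \<gamma> :: "'n::finite \<Rightarrow> 'a"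
  assumes "\<alpha> \<noteq> 0"
  shows "trunc_act \<alpha> \<beta> \<gamma> (single Z 1) v = scale_trunc \<alpha> v"
  by (cases v) (simp add: trunc_act_single[OF assms] trunc_class_scale)

lemma irreducible_trunc_act:
  fixes \<alpha> :: "'a::field" and \<beta> \<gamma> :: "'n::finite \<Rightarrow> 'a"
  assumes "\<alpha> \<noteq> 0" and "CHAR('a) > 0"
  shows "irreducible_act scale_trunc (trunc_act \<alpha> \<beta> \<gamma>)"
  unfolding irreducible_act_def
proof (intro conjI allI impI)
  have "trunc_class 1 \<noteq> (0 :: ('n, 'a) trunc_poly)"
    using assms(2) by (auto simp: trunc_class_eq_0_iff mem_power_ideal_iff intro!: exI[of _ 0])
  then show "(UNIV :: ('n, 'a) trunc_poly set) \<noteq> {0}" by blast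
  fix W :: "('n, 'a) trunc_poly set"
  assume inv: "invariant_subspace scale_trunc (trunc_act \<alpha> \<beta> \<gamma>) W"
  \<comment> \<open>The preimage of \<open>W\<close> among the polynomials, where the criterion for
    invariant subspaces applies.\<close>
  define W' where "W' = {f. trunc_class f \<in> W}"
  have sub: "trunc.subspace W" using inv by (simp add: invariant_subspace_def)
  have inv': "invariant_subspace scale_pm (poly_act \<alpha> \<beta> \<gamma>) W'"
    using inv unfolding invariant_subspace_def
    by (auto simp: W'_def poly.subspace_def trunc.subspace_def trunc_class_0 trunc_class_add trunc_class_scale
        simp flip: trunc_act_trunc_class[OF assms(1)])
  show "W = {0} \<or> W = UNIV"
  proof (rule disjCI)
    assume "W \<noteq> UNIV"
    have "v = 0" if "v \<in> W" for v
    proof (rule ccontr)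
      assume "v \<noteq> 0"
      obtain f where v: "v = trunc_class f" by (rule trunc_class_cases)
      \<comment> \<open>Deleting the monomials of \<open>f\<close> that lie in the ideal gives a
        representative of \<open>v\<close> with all exponents below the characteristic.\<close>
      define g where "g = (\<Sum>m\<in>{m \<in> keys f. \<forall>i. lookup m i < CHAR('a)}. single m (lookup f m))"
      have g: "lookup g m = (if \<forall>i. lookup m i < CHAR('a) then lookup f m else 0)" for m
        by (simp add: g_def lookup_sum lookup_single when_def in_keys_iff)
      then have "trunc_class g = v"
        by (simp add: v trunc_class_eq_iff mem_power_ideal_iff lookup_minus)
      then have "g \<in> W'" "g \<noteq> 0"
        using that \<open>v \<noteq> 0\<close> by (auto simp: W'_def trunc_class_0)
      moreover have "lookup m i < CHAR('a)" if "m \<in> keys g" for m i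
        using that by (simp add: in_keys_iff g split: if_splits)
      ultimately have "W' = UNIV"
        by (intro invariant_subspace_eq_UNIV[OF assms(1) inv']) auto
      then have "rep_trunc_poly w \<in> W'" for w by simp
      then show False
        using \<open>W \<noteq> UNIV\<close> by (auto simp: W'_def)
    qed
    then show "W = {0}"
      using trunc.subspace_0[OF sub] by blast
  qed
qed

section \<open>A monomial basis of the quotient and its dimension\<close>

lemma card_bounded_monomials: "card {m :: 'n::finite \<Rightarrow>\<^sub>0 nat. \<forall>i. lookup m i < p} = p ^ CARD('n)"
proof -
  have "bij_betw lookup {m :: 'n \<Rightarrow>\<^sub>0 nat. \<forall>i. lookup m i < p} (PiE UNIV (\<lambda>_. {..<p}))"
    \<comment> \<open>The index type is finite, so every function on it has finite support and
      \<open>Abs_poly_mapping\<close> inverts \<open>lookup\<close>.\<close>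
    by (rule bij_betw_byWitness[where f' = Abs_poly_mapping]) (auto simp: lookup_inverse)
  then show ?thesis
    by (simp add: bij_betw_same_card card_PiE)
qed

text \<open>The classes of the monomials with exponents below the characteristic form a basis: no
  nonzero combination of these monomials lies in the ideal, and all other monomials do.\<close>

lemma dim_trunc_poly:
  assumes "CHAR('a::field) > 0"
  shows "trunc.dim (UNIV :: ('n::finite, 'a) trunc_poly set) = CHAR('a) ^ CARD('n)"
proof -
  define M where "M = {m :: 'n \<Rightarrow>\<^sub>0 nat. \<forall>i. lookup m i < CHAR('a)}"
  define e where "e = (\<lambda>m. trunc_class (single m 1) :: ('n, 'a) trunc_poly)"
  have card: "card M = CHAR('a) ^ CARD('n)"
    unfolding M_def by (rule card_bounded_monomials)
  \<comment> \<open>An infinite set would have cardinality 0 by convention, but the power is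
    nonzero.\<close>
  then have fin: "finite M"
    using assms by (metis card.infinite power_not_zero less_not_refl)
  have e: "scale_trunc c (e m) = trunc_class (single m c)" for c m
    by (simp add: e_def scale_pm_single flip: trunc_class_scale)
  have inj: "inj_on e M"
  proof (rule inj_onI)
    fix m m'
    assume "m \<in> M" "e m = e m'"
    then have "lookup (single m 1 - single m' 1 :: ('n, 'a) mpoly) m = 0"
      by (simp add: e_def trunc_class_eq_iff mem_power_ideal_iff M_def)
    then show "m = m'"
      by (simp add: lookup_minus lookup_single when_def split: if_splits)
  qed
  have "trunc.independent (e ` M)"
  proof (rule trunc.independent_if_scalars_zero)
    show "finite (e ` M)" using fin by simp
    fix h v
    assume h: "(\<Sum>v\<in>e ` M. scale_trunc (h v) v) = 0" and "v \<in> e ` M"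
    then obtain m where m: "m \<in> M" "v = e m" by blast
    have "trunc_class (\<Sum>m\<in>M. single m (h (e m))) = 0"
      using h by (simp add: sum.reindex[OF inj] e trunc_class_sum)
    then have "lookup (\<Sum>m\<in>M. single m (h (e m))) m = 0"
      using m by (simp add: trunc_class_eq_0_iff mem_power_ideal_iff M_def)
    then show "h v = 0"
      using m fin by (simp add: lookup_sum lookup_single when_def)
  qed
  moreover have "v \<in> trunc.span (e ` M)" for v
  proof -
    obtain f where v: "v = trunc_class f" by (rule trunc_class_cases)
    have "trunc_class (single m c) \<in> trunc.span (e ` M)" for m c
    proof (cases "m \<in> M")
      case True
      then show ?thesis
        unfolding e[symmetric] by (intro trunc.span_scale trunc.span_base) simp
    next
      case False
      then have "trunc_class (single m c) = 0"
        by (auto simp: trunc_class_eq_0_iff mem_power_ideal_iff M_def lookup_single when_def)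
      then show ?thesis by (simp add: trunc.span_zero)
    qed
    then show ?thesis
      unfolding v by (subst poly_mapping_eq_sum_single) (simp add: trunc_class_sum trunc.span_sum)
  qed
  ultimately show ?thesis
    using card card_image[OF inj] by (intro trunc.dim_unique[of "e ` M"]) auto
qed

section \<open>Isomorphism and equivalence\<close>

text \<open>Among the monomials of \<open>f\<close> outside the ideal one of highest degree is mapped by the
  derivative to a monomial of still higher degree, unless \<open>\<delta> = 0\<close>.\<close>

lemma partial_deriv_eigenvalue:
  fixes f :: "('n::finite, 'a::field) mpoly"
  assumes "f \<notin> power_ideal CHAR('a)"
    and eig: "scale_pm \<delta> f + scale_pm \<alpha> (partial_deriv i f) \<in> power_ideal CHAR('a)"
  shows "\<delta> = 0"
proof (rule ccontr)
  assume "\<delta> \<noteq> 0"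
  define K where "K = {m \<in> keys f. \<forall>j. lookup m j < CHAR('a)}"
  have "finite (mono_degree ` K)" "K \<noteq> {}"
    using assms(1) by (auto simp: K_def mem_power_ideal_iff in_keys_iff)
  then have "Max (mono_degree ` K) \<in> mono_degree ` K"
    by (intro Max_in) auto
  then obtain m where m: "m \<in> K" and "Max (mono_degree ` K) = mono_degree m"
    by (rule imageE)
  then have max: "mono_degree k \<le> mono_degree m" if "k \<in> K" for k
    using Max_ge[OF \<open>finite (mono_degree ` K)\<close>, of "mono_degree k"] that by simp
  have "\<delta> * lookup f m + \<alpha> * (of_nat (Suc (lookup m i)) * lookup f (m + single i 1)) = 0"
    using eig m by (simp add: mem_power_ideal_iff K_def lookup_add lookup_partial_deriv del: of_nat_Suc)
  moreover have "lookup f m \<noteq> 0" using m by (simp add: K_def in_keys_iff)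
  ultimately have nz: "of_nat (Suc (lookup m i)) \<noteq> (0 :: 'a)" "lookup f (m + single i 1) \<noteq> 0"
    using \<open>\<delta> \<noteq> 0\<close> by auto
  \<comment> \<open>The nonzero factor keeps the raised exponent from reaching the characteristic,
    so the new monomial is still in \<open>K\<close>.\<close>
  then have "Suc (lookup m i) \<noteq> CHAR('a)" by (metis of_nat_CHAR)
  with m nz have "m + single i 1 \<in> K"
    by (auto simp: K_def in_keys_iff lookup_add lookup_single when_def intro: Suc_lessI)
  from max[OF this] show False by simp
qed

text \<open>Dual to \<open>partial_deriv_eigenvalue\<close>: the coefficient of
  \<open>Var i * f\<close> at a monomial of lowest degree outside the ideal comes from a monomial of
  still lower degree, which is again outside the ideal.\<close>

lemma Var_eigenvalue:
  fixes f :: "('n::finite, 'a::field) mpoly"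
  assumes "f \<notin> power_ideal CHAR('a)"
    and eig: "scale_pm \<delta> f + Var i * f \<in> power_ideal CHAR('a)"
  shows "\<delta> = 0"
proof (rule ccontr)
  assume "\<delta> \<noteq> 0"
  define K where "K = {m \<in> keys f. \<forall>j. lookup m j < CHAR('a)}"
  have "finite (mono_degree ` K)" "K \<noteq> {}"
    using assms(1) by (auto simp: K_def mem_power_ideal_iff in_keys_iff)
  then have "Min (mono_degree ` K) \<in> mono_degree ` K"
    by (intro Min_in) auto
  then obtain m where m: "m \<in> K" and "Min (mono_degree ` K) = mono_degree m"
    by (rule imageE)
  then have min: "mono_degree m \<le> mono_degree k" if "k \<in> K" for k
    using Min_le[OF \<open>finite (mono_degree ` K)\<close>, of "mono_degree k"] that by simp
  have "\<delta> * lookup f m + (if lookup m i = 0 then 0 else lookup f (m - single i 1)) = 0"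
    using eig m by (simp add: mem_power_ideal_iff K_def lookup_add lookup_Var_mult)
  moreover have "lookup f m \<noteq> 0" using m by (simp add: K_def in_keys_iff)
  ultimately have i: "lookup m i > 0" and nz: "lookup f (m - single i 1) \<noteq> 0"
    using \<open>\<delta> \<noteq> 0\<close> by (auto split: if_splits)
  with m have "m - single i 1 \<in> K"
    by (auto simp: K_def in_keys_iff lookup_minus intro: le_less_trans[OF diff_le_self])
  then have "mono_degree m \<le> mono_degree (m - single i 1)" by (rule min)
  moreover have "mono_degree (m - single i 1) + 1 = mono_degree m"
    using i by (metis mono_degree_add_single minus_single_add_single Suc_leI One_nat_def)
  ultimately show False by simp
qed

section \<open>Classification up to isomorphism and equivalence\<close>

lemma isomorphic_act_refl: "vector_space scaleV \<Longrightarrow> isomorphic_act scaleV act scaleV act"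
  unfolding isomorphic_act_def by (intro exI[of _ id]) (simp add: Vector_Spaces.linear_iff)

text \<open>An isomorphism preserves eigenvalues, so it suffices to exhibit one eigenvector for each
  generator in the first module and to compare with the only possible eigenvalue in the
  second.\<close>

lemma isomorphic_trunc_act_iff:
  fixes \<alpha> \<alpha>' :: "'a::field" and \<beta> \<gamma> \<beta>' \<gamma>' :: "'n::finite \<Rightarrow> 'a"
  assumes "\<alpha> \<noteq> 0" "\<alpha>' \<noteq> 0" and char: "CHAR('a) > 0"
  shows "isomorphic_act scale_trunc (trunc_act \<alpha> \<beta> \<gamma>) scale_trunc (trunc_act \<alpha>' \<beta>' \<gamma>')
    \<longleftrightarrow> \<alpha> = \<alpha>' \<and> \<beta> = \<beta>' \<and> \<gamma> = \<gamma>'"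
proof
  assume "isomorphic_act scale_trunc (trunc_act \<alpha> \<beta> \<gamma>) scale_trunc (trunc_act \<alpha>' \<beta>' \<gamma>')"
  then obtain \<phi> :: "('n, 'a) trunc_poly \<Rightarrow> ('n, 'a) trunc_poly"
    where lin: "Vector_Spaces.linear scale_trunc scale_trunc \<phi>" and "bij \<phi>"
      and \<phi>: "\<And>u v. \<phi> (trunc_act \<alpha> \<beta> \<gamma> u v) = trunc_act \<alpha>' \<beta>' \<gamma>' u (\<phi> v)"
    unfolding isomorphic_act_def by blast
  have scale: "\<phi> (scale_trunc c v) = scale_trunc c (\<phi> v)" for c v
    using lin by (simp add: Vector_Spaces.linear_iff)
  have "\<phi> 0 = 0" using scale[of 0 0] by simp
  then have nz: "\<phi> v \<noteq> 0" if "v \<noteq> 0" for v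
    using \<open>bij \<phi>\<close> that by (metis bij_is_inj injD)
  have one: "trunc_class 1 \<noteq> (0 :: ('n, 'a) trunc_poly)"
    using char by (auto simp: trunc_class_eq_0_iff mem_power_ideal_iff intro!: exI[of _ 0])
  \<comment> \<open>The image of an eigenvector, lifted to a polynomial outside the ideal: the
    eigenvalue equation becomes a congruence.\<close>
  have eigenvector: "\<exists>f. f \<notin> power_ideal CHAR('a) \<and>
      poly_act_basis \<alpha>' \<beta>' \<gamma>' b f - scale_pm c f \<in> power_ideal CHAR('a)"
    if "trunc_act \<alpha> \<beta> \<gamma> (single b 1) v = scale_trunc c v" "v \<noteq> 0" for b c v
  proof -
    obtain f where f: "\<phi> v = trunc_class f" by (rule trunc_class_cases)
    have "trunc_act \<alpha>' \<beta>' \<gamma>' (single b 1) (trunc_class f) = scale_trunc c (trunc_class f)"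
      using that(1) by (simp add: scale flip: f \<phi>)
    then have "trunc_class (poly_act_basis \<alpha>' \<beta>' \<gamma>' b f) = trunc_class (scale_pm c f)"
      by (simp add: trunc_act_single[OF assms(2)] trunc_class_scale)
    then show ?thesis
      using nz[OF that(2)] by (auto simp: f trunc_class_eq_iff trunc_class_eq_0_iff)
  qed
  have "scale_trunc \<alpha> (\<phi> (trunc_class 1)) = scale_trunc \<alpha>' (\<phi> (trunc_class 1))"
    using \<phi>[of "single Z 1" "trunc_class 1"] by (simp add: trunc_act_Z assms scale)
  then have "\<alpha> = \<alpha>'" using nz[OF one] by simp
  moreover have "\<beta> i = \<beta>' i" for i
  proof -
    \<comment> \<open>The constant 1 is killed by the derivative, so it is an eigenvector of
      \<open>X i\<close>.\<close>
    have "partial_deriv i (1 :: ('n, 'a) mpoly) = 0"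
      by (simp add: partial_deriv_def)
    then have "trunc_act \<alpha> \<beta> \<gamma> (single (X i) 1) (trunc_class 1) = scale_trunc (\<beta> i) (trunc_class 1)"
      by (simp add: trunc_act_single assms trunc_class_scale)
    from eigenvector[OF this one] obtain f where "f \<notin> power_ideal CHAR('a)"
      "scale_pm (\<beta>' i - \<beta> i) f + scale_pm \<alpha>' (partial_deriv i f) \<in> power_ideal CHAR('a)"
      by (auto simp: poly.scale_left_diff_distrib algebra_simps)
    then have "\<beta>' i - \<beta> i = 0" by (rule partial_deriv_eigenvalue)
    then show ?thesis by simp
  qed
  moreover have "\<gamma> i = \<gamma>' i" for i
  proof -
    \<comment> \<open>The highest power of the variable that survives in the quotient: multiplying
      by \<open>Var i\<close> once more gives 0, so it is an eigenvector of
      \<open>Y i\<close>.\<close>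
    define v where "v = (trunc_class (Var i ^ (CHAR('a) - 1)) :: ('n, 'a) trunc_poly)"
    have "v \<noteq> 0"
      using char by (auto simp: v_def Var_power trunc_class_eq_0_iff mem_power_ideal_iff lookup_single when_def
          intro!: exI[of _ "single i (CHAR('a) - 1)"])
    have "Var i * Var i ^ (CHAR('a) - 1) \<in> (power_ideal CHAR('a) :: ('n, 'a) mpoly set)"
      using Var_power_in_power_ideal[of i "CHAR('a)"] char by (simp flip: power_Suc)
    then have "trunc_act \<alpha> \<beta> \<gamma> (single (Y i) 1) v = scale_trunc (\<gamma> i) v"
      unfolding v_def by (simp add: trunc_act_single assms trunc_class_eq_iff flip: trunc_class_scale)
    from eigenvector[OF this \<open>v \<noteq> 0\<close>] obtain f where "f \<notin> power_ideal CHAR('a)"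
      "scale_pm (\<gamma>' i - \<gamma> i) f + Var i * f \<in> power_ideal CHAR('a)"
      by (auto simp: poly.scale_left_diff_distrib algebra_simps)
    then have "\<gamma>' i - \<gamma> i = 0" by (rule Var_eigenvalue)
    then show ?thesis by simp
  qed
  ultimately show "\<alpha> = \<alpha>' \<and> \<beta> = \<beta>' \<and> \<gamma> = \<gamma>'" by auto
qed (simp add: isomorphic_act_refl vector_space_scale_trunc)

text \<open>The automorphism sends \<open>z\<close> to \<open>z / \<alpha>\<close>, \<open>x\<^sub>i\<close> to \<open>x\<^sub>i / \<alpha> - \<beta>\<^sub>i z / \<alpha>\<^sup>2\<close>
  and \<open>y\<^sub>i\<close> to \<open>y\<^sub>i - \<gamma>\<^sub>i z / \<alpha>\<close>.\<close>

lemma poly_act_normalize: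
  fixes \<alpha> :: "'a::field" and \<beta> \<gamma> :: "'n::finite \<Rightarrow> 'a"
  assumes "\<alpha> \<noteq> 0"
  shows "\<exists>\<Omega>. lie_automorphism scale_pm heis_bracket \<Omega> \<and>
    (\<forall>u. poly_act \<alpha> \<beta> \<gamma> (\<Omega> u) = poly_act 1 (\<lambda>_. 0) (\<lambda>_. 0) u)"
proof -
  \<comment> \<open>The \<open>Z\<close> coordinate is solved from the requirement that the scalar
    part of the action of \<open>\<Omega> u\<close> be \<open>lookup u Z\<close>; dividing the
    \<open>X\<close> coordinates by \<alpha> cancels the factor of the derivation.\<close>
  define \<Omega> :: "('n, 'a) heisenberg \<Rightarrow> ('n, 'a) heisenberg" where
    "\<Omega> u = Abs_poly_mapping (\<lambda>b. case b of
        X i \<Rightarrow> lookup u (X i) / \<alpha>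
      | Y i \<Rightarrow> lookup u (Y i)
      | Z \<Rightarrow> (lookup u Z - (\<Sum>i\<in>UNIV. lookup u (X i) / \<alpha> * \<beta> i) - (\<Sum>i\<in>UNIV. lookup u (Y i) * \<gamma> i)) / \<alpha>)" for u
  \<comment> \<open>The explicit inverse, from which bijectivity follows.\<close>
  define \<Omega>' :: "('n, 'a) heisenberg \<Rightarrow> ('n, 'a) heisenberg" where
    "\<Omega>' u = Abs_poly_mapping (\<lambda>b. case b of
        X i \<Rightarrow> lookup u (X i) * \<alpha>
      | Y i \<Rightarrow> lookup u (Y i)
      | Z \<Rightarrow> lookup u Z * \<alpha> + (\<Sum>i\<in>UNIV. lookup u (X i) * \<beta> i) + (\<Sum>i\<in>UNIV. lookup u (Y i) * \<gamma> i))" for u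
  have \<Omega>: "lookup (\<Omega> u) (X i) = lookup u (X i) / \<alpha>" "lookup (\<Omega> u) (Y i) = lookup u (Y i)"
    "lookup (\<Omega> u) Z
      = (lookup u Z - (\<Sum>i\<in>UNIV. lookup u (X i) / \<alpha> * \<beta> i) - (\<Sum>i\<in>UNIV. lookup u (Y i) * \<gamma> i)) / \<alpha>" for u i
    by (simp_all add: \<Omega>_def)
  have \<Omega>': "lookup (\<Omega>' u) (X i) = lookup u (X i) * \<alpha>" "lookup (\<Omega>' u) (Y i) = lookup u (Y i)"
    "lookup (\<Omega>' u) Z
      = lookup u Z * \<alpha> + (\<Sum>i\<in>UNIV. lookup u (X i) * \<beta> i) + (\<Sum>i\<in>UNIV. lookup u (Y i) * \<gamma> i)" for u i
    by (simp_all add: \<Omega>'_def)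
  have eqI: "u = w"
    if "\<And>i. lookup u (X i) = lookup w (X i)" "\<And>i. lookup u (Y i) = lookup w (Y i)" "lookup u Z = lookup w Z"
    for u w :: "('n, 'a) heisenberg"
    using that by (metis heis_basis.exhaust poly_mapping_eqI)
  have "\<Omega>' (\<Omega> u) = u" "\<Omega> (\<Omega>' u) = u" for u
    by (rule eqI; simp add: \<Omega> \<Omega>' assms)+
  then have "bij \<Omega>"
    by (intro o_bij[of \<Omega>']) auto
  moreover have "Vector_Spaces.linear scale_pm scale_pm \<Omega>"
    unfolding linear_scale_pm_iff
    by (auto intro!: eqI simp: \<Omega> lookup_add add_divide_distrib diff_divide_distrib sum.distrib sum_distrib_left
        algebra_simps)
  moreover have "\<Omega> (heis_bracket u w) = heis_bracket (\<Omega> u) (\<Omega> w)" for u w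
    by (rule eqI) (simp_all add: \<Omega> heis_bracket_eq lookup_single sum_divide_distrib diff_divide_distrib)
  moreover have "poly_act \<alpha> \<beta> \<gamma> (\<Omega> u) f = poly_act 1 (\<lambda>_. 0) (\<lambda>_. 0) u f" for u f
    using assms lin_deriv_scale_left[of "1 / \<alpha>" "\<lambda>i. lookup u (X i)" f]
    by (simp add: poly_act_eq \<Omega> flip: mult.assoc single_0_mult)
  ultimately show ?thesis
    unfolding lie_automorphism_def by blast
qed

lemma equivalent_trunc_act:
  fixes \<alpha> :: "'a::field" and \<beta> \<gamma> :: "'n::finite \<Rightarrow> 'a"
  assumes "\<alpha> \<noteq> 0"
  shows "equivalent_act scale_pm (heis_bracket :: ('n, 'a) heisenberg \<Rightarrow> _)
    scale_trunc (trunc_act \<alpha> \<beta> \<gamma>) scale_trunc (trunc_act 1 (\<lambda>_. 0) (\<lambda>_. 0))"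
proof -
  obtain \<Omega> where "lie_automorphism scale_pm (heis_bracket :: ('n, 'a) heisenberg \<Rightarrow> _) \<Omega>"
    and "\<And>u. poly_act \<alpha> \<beta> \<gamma> (\<Omega> u) = poly_act 1 (\<lambda>_. 0) (\<lambda>_. 0) u"
    using poly_act_normalize[OF assms] by blast
  \<comment> \<open>The twisted action equals the normalized one already on representatives, so the
    identity is the required isomorphism.\<close>
  moreover from this(2) have "trunc_act \<alpha> \<beta> \<gamma> \<circ> \<Omega> = trunc_act 1 (\<lambda>_. 0) (\<lambda>_. 0)"
    by (simp add: fun_eq_iff trunc_act_def)
  ultimately show ?thesis
    unfolding equivalent_act_def by (metis isomorphic_act_refl vector_space_scale_trunc)
qed

theorem proposition2p1:
  fixes \<alpha> :: "'a::field" and \<beta> \<gamma> :: "'n::finite \<Rightarrow> 'a"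
  assumes "\<alpha> \<noteq> 0"
  shows
    "(lie_module scale_pm (heis_bracket :: ('n, 'a) heisenberg \<Rightarrow> _) scale_pm (poly_act \<alpha> \<beta> \<gamma>) \<and>
      faithful_act (poly_act \<alpha> \<beta> \<gamma>)) \<and>
     (irreducible_act scale_pm (poly_act \<alpha> \<beta> \<gamma>) \<longleftrightarrow> CHAR('a) = 0) \<and>
     (\<forall>p. prime p \<and> CHAR('a) = p \<longrightarrow>
        invariant_subspace scale_pm (poly_act \<alpha> \<beta> \<gamma>) (power_ideal p) \<and>
        (\<forall>u f. trunc_act \<alpha> \<beta> \<gamma> u (trunc_class f) = trunc_class (poly_act \<alpha> \<beta> \<gamma> u f)) \<and>
        lie_module scale_pm (heis_bracket :: ('n, 'a) heisenberg \<Rightarrow> _)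
          scale_trunc (trunc_act \<alpha> \<beta> \<gamma>) \<and>
        faithful_act (trunc_act \<alpha> \<beta> \<gamma>) \<and>
        irreducible_act scale_trunc (trunc_act \<alpha> \<beta> \<gamma>) \<and>
        vector_space.dim scale_trunc (UNIV :: ('n, 'a) trunc_poly set) = p ^ CARD('n) \<and>
        (\<forall>\<alpha>' \<beta>' \<gamma>'. \<alpha>' \<noteq> 0 \<longrightarrow>
           (isomorphic_act scale_trunc (trunc_act \<alpha> \<beta> \<gamma>) scale_trunc (trunc_act \<alpha>' \<beta>' \<gamma>') \<longleftrightarrow>
            \<alpha> = \<alpha>' \<and> (\<forall>i. \<beta> i = \<beta>' i \<and> \<gamma> i = \<gamma>' i))) \<and>
        equivalent_act scale_pm (heis_bracket :: ('n, 'a) heisenberg \<Rightarrow> _)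
          scale_trunc (trunc_act \<alpha> \<beta> \<gamma>)
          scale_trunc (trunc_act 1 (\<lambda>_. 0) (\<lambda>_. 0)))"
proof (intro conjI allI impI)
  show "lie_module scale_pm (heis_bracket :: ('n, 'a) heisenberg \<Rightarrow> _) scale_pm (poly_act \<alpha> \<beta> \<gamma>)"
    by (rule lie_module_poly_act)
  then show "faithful_act (poly_act \<alpha> \<beta> \<gamma>)"
    by (rule heisenberg_module_faithful[where \<alpha> = \<alpha> and v = 1]) (simp_all add: poly_act_single assms)
  show "irreducible_act scale_pm (poly_act \<alpha> \<beta> \<gamma>) \<longleftrightarrow> CHAR('a) = 0"
    by (rule irreducible_poly_act_iff[OF assms])
next
  fix p
  assume p: "prime p \<and> CHAR('a) = p"
  then have char: "CHAR('a) > 0" by (simp add: prime_gt_0_nat)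
  show "invariant_subspace scale_pm (poly_act \<alpha> \<beta> \<gamma>) (power_ideal p)"
    using invariant_power_ideal[OF assms] p by blast
  show "trunc_act \<alpha> \<beta> \<gamma> u (trunc_class f) = trunc_class (poly_act \<alpha> \<beta> \<gamma> u f)" for u f
    by (rule trunc_act_trunc_class[OF assms])
  show mod: "lie_module scale_pm (heis_bracket :: ('n, 'a) heisenberg \<Rightarrow> _) scale_trunc (trunc_act \<alpha> \<beta> \<gamma>)"
    by (rule lie_module_trunc_act[OF assms])
  show irr: "irreducible_act scale_trunc (trunc_act \<alpha> \<beta> \<gamma>)"
    by (rule irreducible_trunc_act[OF assms char])
  \<comment> \<open>Irreducibility includes that the space is nonzero, which supplies the vector
    needed for faithfulness.\<close>
  then obtain v :: "('n, 'a) trunc_poly" where "v \<noteq> 0"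
    unfolding irreducible_act_def by blast
  with mod show "faithful_act (trunc_act \<alpha> \<beta> \<gamma>)"
    using heisenberg_module_faithful trunc_act_Z assms by blast
  show "vector_space.dim scale_trunc (UNIV :: ('n, 'a) trunc_poly set) = p ^ CARD('n)"
    using dim_trunc_poly[OF char, where 'n = 'n] p by simp
  show "isomorphic_act scale_trunc (trunc_act \<alpha> \<beta> \<gamma>) scale_trunc (trunc_act \<alpha>' \<beta>' \<gamma>')
      \<longleftrightarrow> \<alpha> = \<alpha>' \<and> (\<forall>i. \<beta> i = \<beta>' i \<and> \<gamma> i = \<gamma>' i)" if "\<alpha>' \<noteq> 0" for \<alpha>' \<beta>' \<gamma>'
    using isomorphic_trunc_act_iff[OF assms that char, of \<beta> \<gamma> \<beta>' \<gamma>'] by (auto simp: fun_eq_iff)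
  show "equivalent_act scale_pm (heis_bracket :: ('n, 'a) heisenberg \<Rightarrow> _)
      scale_trunc (trunc_act \<alpha> \<beta> \<gamma>) scale_trunc (trunc_act 1 (\<lambda>_. 0) (\<lambda>_. 0))"
    by (rule equivalent_trunc_act[OF assms])
qed

end
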